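(* Given $b\in\mathbb D$, there exists $r_b>0$ such that if $c\in\mathbb D$ and $|c-b|<r_b$ then, for all $\varphi\in\mathcal M(\mathcal H^\infty(B_{c_0}))$, $R_b(\varphi)$ and $R_c(\varphi)$ are in the same Gleason part of $\mathcal M(\mathcal H^\infty(B_{c_0}))$.
   Context: $\mathbb D$ is the open unit disc of $\mathbb C$; $c_0$ is the complex Banach space of null sequences with open unit ball $B_{c_0}$. $\mathcal H^\infty(B_{c_0})$ is the Banach algebra (sup norm) of bounded holomorphic functions $f\colon B_{c_0}\to\mathbb C$, and $\mathcal M(\mathcal H^\infty(B_{c_0}))$ is the set of its nonzero $\mathbb C$-valued algebra homomorphisms. The Gleason parts are the equivalence classes of the relation $\varphi\sim\psi$ iff $\rho(\varphi,\psi)<1$, where $\rho(\varphi,\psi)=\sup\{|\varphi(f)| \mid f\in\mathcal H^\infty(B_{c_0}),\ \|f\|\le1,\ \psi(f)=0\}$ (equivalently, $\|\varphi-\psi\|=\sup_{\|f\|\le1}|\varphi(f)-\psi(f)|<2$). For $b\in\mathbb D$, $\Lambda_b\colon B_{c_0}\to B_{c_0}$ is $\Lambda_b(z)=(b,z)=(b,z_1,z_2,\dots)$, and for $\varphi\in\mathcal M(\mathcal H^\infty(B_{c_0}))$, $R_b(\varphi)\in\mathcal M(\mathcal H^\infty(B_{c_0}))$ is defined by $R_b(\varphi)(f)=\varphi(f\circ\Lambda_b)$ for $f\in\mathcal H^\infty(B_{c_0})$. *)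

theory Defs
  imports "HOL-Analysis.Analysis"
begin

section \<open>The complex Banach space of null sequences\<close>

typedef c0 = "{x :: nat \<Rightarrow> complex. x \<longlonglongrightarrow> 0}"
  morphisms seq_of C0
  by (rule exI[of _ "\<lambda>_. 0"]) simp

setup_lifting type_definition_c0

lemma seq_of_tendsto: "seq_of x \<longlonglongrightarrow> 0"
  using seq_of[of x] by simp

lemma c0_eq_iff: "x = y \<longleftrightarrow> (\<forall>n. seq_of x n = seq_of y n)"
  by (simp add: seq_of_inject[symmetric] fun_eq_iff)

lemma seq_of_bdd: "bdd_above (range (\<lambda>n. cmod (seq_of x n)))"
proof -
  have "Bseq (seq_of x)"
    using seq_of_tendsto[of x] by (auto intro: convergent_imp_Bseq convergentI)
  then obtain K where "\<And>n. cmod (seq_of x n) \<le> K"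
    by (auto simp: Bseq_def)
  then show ?thesis
    by (auto intro!: bdd_aboveI)
qed

instantiation c0 :: real_vector
begin

lift_definition zero_c0 :: c0 is "\<lambda>_. 0" by simp

lift_definition plus_c0 :: "c0 \<Rightarrow> c0 \<Rightarrow> c0" is "\<lambda>x y n. x n + y n"
  by (drule (1) tendsto_add) simp

lift_definition minus_c0 :: "c0 \<Rightarrow> c0 \<Rightarrow> c0" is "\<lambda>x y n. x n - y n"
  by (drule (1) tendsto_diff) simp

lift_definition uminus_c0 :: "c0 \<Rightarrow> c0" is "\<lambda>x n. - x n"
  by (drule tendsto_minus) simp

lift_definition scaleR_c0 :: "real \<Rightarrow> c0 \<Rightarrow> c0" is "\<lambda>a x n. a *\<^sub>R x n"
  by (drule tendsto_scaleR[OF tendsto_const]) simp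

instance
  by standard
    (simp_all add: c0_eq_iff zero_c0.rep_eq plus_c0.rep_eq minus_c0.rep_eq uminus_c0.rep_eq
      scaleR_c0.rep_eq algebra_simps)

end

instantiation c0 :: real_normed_vector
begin

definition norm_c0 :: "c0 \<Rightarrow> real"
  where "norm_c0 x = (SUP n. cmod (seq_of x n))"

definition dist_c0 :: "c0 \<Rightarrow> c0 \<Rightarrow> real"
  where "dist_c0 x y = norm (x - y)"

definition sgn_c0 :: "c0 \<Rightarrow> c0"
  where "sgn_c0 x = x /\<^sub>R norm x"

definition uniformity_c0 :: "(c0 \<times> c0) filter"
  where "uniformity_c0 = (INF e\<in>{0 <..}. principal {(x, y). dist x y < e})"

definition open_c0 :: "c0 set \<Rightarrow> bool"
  where "open_c0 U = (\<forall>x\<in>U. eventually (\<lambda>(x', y). x' = x \<longrightarrow> y \<in> U) uniformity)"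

lemma c0_norm_ge: "cmod (seq_of x n) \<le> norm (x :: c0)"
  unfolding norm_c0_def by (intro cSUP_upper seq_of_bdd) simp

lemma c0_norm_le: "(\<And>n. cmod (seq_of x n) \<le> K) \<Longrightarrow> norm (x :: c0) \<le> K"
  unfolding norm_c0_def by (intro cSUP_least) auto

instance
proof
  fix x y :: c0 and a :: real
  show "norm x = 0 \<longleftrightarrow> x = 0"
  proof
    assume "norm x = 0"
    then have "seq_of x n = 0" for n
      using c0_norm_ge[of x n] by simp
    then show "x = 0"
      by transfer (simp add: fun_eq_iff)
  next
    assume "x = 0"
    then show "norm x = 0"
      by (simp add: norm_c0_def zero_c0.rep_eq)
  qed
  show "norm (x + y) \<le> norm x + norm y"
    by (rule c0_norm_le)
      (simp add: plus_c0.rep_eq norm_triangle_le add_mono c0_norm_ge)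
  show "norm (a *\<^sub>R x) = \<bar>a\<bar> * norm x"
  proof -
    have *: "norm (a *\<^sub>R x) \<le> \<bar>a\<bar> * norm x" for a and x :: c0
      by (rule c0_norm_le)
        (simp add: scaleR_c0.rep_eq c0_norm_ge mult_left_mono)
    show ?thesis
    proof (cases "a = 0")
      case True
      have "norm (0 :: c0) = 0"
        by (simp add: norm_c0_def zero_c0.rep_eq)
      with True show ?thesis
        by simp
    next
      case False
      have "norm x \<le> \<bar>inverse a\<bar> * norm (a *\<^sub>R x)"
        using *[of "inverse a" "a *\<^sub>R x"] False by simp
      then have "\<bar>a\<bar> * norm x \<le> norm (a *\<^sub>R x)"
        using False by (simp add: field_simps abs_inverse)
      with *[of a x] show ?thesis
        by simp
    qed
  qed
qed (fact dist_c0_def sgn_c0_def uniformity_c0_def open_c0_def)+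

end

lift_definition scaleC_c0 :: "complex \<Rightarrow> c0 \<Rightarrow> c0" is "\<lambda>a x n. a * x n"
  by (drule tendsto_mult[OF tendsto_const]) simp

lift_definition cons_c0 :: "complex \<Rightarrow> c0 \<Rightarrow> c0" is "\<lambda>b x. case_nat b x"
  by (subst filterlim_sequentially_Suc[symmetric]) simp

lemma cons_c0_in_ball:
  assumes "cmod b < 1" and "norm z < 1"
  shows "norm (cons_c0 b z) < 1"
proof -
  have "norm (cons_c0 b z) \<le> max (cmod b) (norm z)"
    by (rule c0_norm_le)
      (auto simp: cons_c0.rep_eq c0_norm_ge le_max_iff_disj split: nat.split)
  with assms show ?thesis
    by simp
qed

lemma cons_c0_in_ballD:
  assumes "norm (cons_c0 b z) < 1"
  shows "norm z < 1"
proof -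
  have "norm z \<le> norm (cons_c0 b z)"
  proof (rule c0_norm_le)
    fix n show "cmod (seq_of z n) \<le> norm (cons_c0 b z)"
      using c0_norm_ge[of "cons_c0 b z" "Suc n"] by (simp add: cons_c0.rep_eq)
  qed
  with assms show ?thesis
    by simp
qed

section \<open>Bounded holomorphic functions on the unit ball\<close>

text \<open>Holomorphic means complex Frechet differentiable: \<^const>\<open>has_derivative\<close> only
  provides a bounded real-linear derivative, so complex homogeneity is required in addition.\<close>

definition c0_holomorphic_on :: "(c0 \<Rightarrow> complex) \<Rightarrow> c0 set \<Rightarrow> bool"
  where "c0_holomorphic_on f U \<longleftrightarrow>
    (\<forall>z\<in>U. \<exists>D. (f has_derivative D) (at z) \<and> (\<forall>a h. D (scaleC_c0 a h) = a * D h))"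

text \<open>A function on the open unit ball is represented by its extension by zero to the whole
  space; since the ball is open, the values outside do not affect holomorphy on the ball.\<close>

typedef Hinf = "{f :: c0 \<Rightarrow> complex. c0_holomorphic_on f (ball 0 1) \<and>
    bounded (f ` ball 0 1) \<and> (\<forall>z. z \<notin> ball 0 1 \<longrightarrow> f z = 0)}"
  morphisms fun_of Hinf
proof
  show "(\<lambda>_. 0) \<in> {f :: c0 \<Rightarrow> complex. c0_holomorphic_on f (ball 0 1) \<and>
    bounded (f ` ball 0 1) \<and> (\<forall>z. z \<notin> ball 0 1 \<longrightarrow> f z = 0)}"
    by (auto simp: c0_holomorphic_on_def bounded_iff intro!: exI[of _ "\<lambda>_. 0"])
qed

setup_lifting type_definition_Hinf

lemma fun_of_outside: "\<not> norm z < 1 \<Longrightarrow> fun_of f z = 0"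
  using fun_of[of f] by (simp add: dist_norm)

lemma Hinf_eq_iff: "f = g \<longleftrightarrow> (\<forall>z. fun_of f z = fun_of g z)"
  by (simp add: fun_of_inject[symmetric] fun_eq_iff)

lemma fun_of_bdd: "bdd_above ((\<lambda>z. cmod (fun_of f z)) ` ball 0 1)"
  using fun_of[of f] by (auto simp: bounded_iff bdd_above_def)

lemma c0_holomorphic_on_const: "c0_holomorphic_on (\<lambda>_. k) U"
  by (auto simp: c0_holomorphic_on_def intro!: exI[of _ "\<lambda>_. 0"])

lemma c0_holomorphic_on_add:
  assumes "c0_holomorphic_on f U" "c0_holomorphic_on g U"
  shows "c0_holomorphic_on (\<lambda>z. f z + g z) U"
  unfolding c0_holomorphic_on_def
proof
  fix z assume "z \<in> U"
  then obtain D E where "(f has_derivative D) (at z)" "\<forall>a h. D (scaleC_c0 a h) = a * D h"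
      "(g has_derivative E) (at z)" "\<forall>a h. E (scaleC_c0 a h) = a * E h"
    using assms unfolding c0_holomorphic_on_def by meson
  then show "\<exists>D. ((\<lambda>z. f z + g z) has_derivative D) (at z) \<and>
      (\<forall>a h. D (scaleC_c0 a h) = a * D h)"
    by (intro exI[of _ "\<lambda>h. D h + E h"] conjI has_derivative_add)
      (auto simp: algebra_simps)
qed

lemma c0_holomorphic_on_mult:
  assumes "c0_holomorphic_on f U" "c0_holomorphic_on g U"
  shows "c0_holomorphic_on (\<lambda>z. f z * g z) U"
  unfolding c0_holomorphic_on_def
proof
  fix z assume "z \<in> U"
  then obtain D E where "(f has_derivative D) (at z)" "\<forall>a h. D (scaleC_c0 a h) = a * D h"
      "(g has_derivative E) (at z)" "\<forall>a h. E (scaleC_c0 a h) = a * E h"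
    using assms unfolding c0_holomorphic_on_def by meson
  then show "\<exists>D. ((\<lambda>z. f z * g z) has_derivative D) (at z) \<and>
      (\<forall>a h. D (scaleC_c0 a h) = a * D h)"
    by (intro exI[of _ "\<lambda>h. f z * E h + D h * g z"] conjI has_derivative_mult)
      (auto simp: algebra_simps)
qed

lemma c0_holomorphic_on_cong:
  assumes "open U" and "\<And>z. z \<in> U \<Longrightarrow> f z = g z"
  shows "c0_holomorphic_on f U \<longleftrightarrow> c0_holomorphic_on g U"
proof -
  have "(f has_derivative D) (at z) \<longleftrightarrow> (g has_derivative D) (at z)" if "z \<in> U" for z D
    using that assms has_derivative_transform_within_open[of _ _ z UNIV U] by metis
  then show ?thesis
    by (simp add: c0_holomorphic_on_def)
qed

lemma bounded_mult_image:
  fixes f g :: "'a \<Rightarrow> complex"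
  assumes "bounded (f ` S)" "bounded (g ` S)"
  shows "bounded ((\<lambda>z. f z * g z) ` S)"
proof -
  obtain A B where "\<And>z. z \<in> S \<Longrightarrow> cmod (f z) \<le> A" "\<And>z. z \<in> S \<Longrightarrow> cmod (g z) \<le> B"
    using assms by (auto simp: bounded_iff)
  then have "cmod (f z * g z) \<le> A * B" if "z \<in> S" for z
    unfolding norm_mult using that by (intro mult_mono') auto
  then show ?thesis
    by (auto simp: bounded_iff)
qed

lift_definition scaleC_Hinf :: "complex \<Rightarrow> Hinf \<Rightarrow> Hinf" is "\<lambda>a f z. a * f z"
  by (auto intro!: c0_holomorphic_on_mult bounded_mult_image
      simp: c0_holomorphic_on_const image_constant_conv)

instantiation Hinf :: "{comm_ring_1, real_algebra_1}"
begin

lift_definition zero_Hinf :: Hinf is "\<lambda>_. 0"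
  by (auto simp: c0_holomorphic_on_const bounded_iff)

lift_definition one_Hinf :: Hinf is "\<lambda>z. if z \<in> ball 0 1 then 1 else 0"
  by (subst c0_holomorphic_on_cong[where g = "\<lambda>_. 1"])
    (auto simp: c0_holomorphic_on_const bounded_iff)

lift_definition plus_Hinf :: "Hinf \<Rightarrow> Hinf \<Rightarrow> Hinf" is "\<lambda>f g z. f z + g z"
  by (auto intro: c0_holomorphic_on_add bounded_plus_comp)

lift_definition times_Hinf :: "Hinf \<Rightarrow> Hinf \<Rightarrow> Hinf" is "\<lambda>f g z. f z * g z"
  by (auto intro: c0_holomorphic_on_mult bounded_mult_image)

definition uminus_Hinf :: "Hinf \<Rightarrow> Hinf"
  where "uminus_Hinf f = scaleC_Hinf (-1) f"

definition minus_Hinf :: "Hinf \<Rightarrow> Hinf \<Rightarrow> Hinf"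
  where "minus_Hinf f g = f + (- g)"

definition scaleR_Hinf :: "real \<Rightarrow> Hinf \<Rightarrow> Hinf"
  where "scaleR_Hinf a f = scaleC_Hinf (complex_of_real a) f"

instance
proof
  show "(0 :: Hinf) \<noteq> 1"
    by (auto simp: Hinf_eq_iff zero_Hinf.rep_eq one_Hinf.rep_eq intro!: exI[of _ 0])
qed (simp_all add: Hinf_eq_iff minus_Hinf_def uminus_Hinf_def scaleR_Hinf_def zero_Hinf.rep_eq
    one_Hinf.rep_eq plus_Hinf.rep_eq times_Hinf.rep_eq scaleC_Hinf.rep_eq fun_of_outside
    algebra_simps)

end

instantiation Hinf :: real_normed_algebra_1
begin

definition norm_Hinf :: "Hinf \<Rightarrow> real"
  where "norm_Hinf f = (SUP z\<in>ball 0 1. cmod (fun_of f z))"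

definition dist_Hinf :: "Hinf \<Rightarrow> Hinf \<Rightarrow> real"
  where "dist_Hinf f g = norm (f - g)"

definition sgn_Hinf :: "Hinf \<Rightarrow> Hinf"
  where "sgn_Hinf f = f /\<^sub>R norm f"

definition uniformity_Hinf :: "(Hinf \<times> Hinf) filter"
  where "uniformity_Hinf = (INF e\<in>{0 <..}. principal {(x, y). dist x y < e})"

definition open_Hinf :: "Hinf set \<Rightarrow> bool"
  where "open_Hinf U = (\<forall>x\<in>U. eventually (\<lambda>(x', y). x' = x \<longrightarrow> y \<in> U) uniformity)"

lemma Hinf_norm_le:
  "(\<And>z. norm z < 1 \<Longrightarrow> cmod (fun_of f z) \<le> K) \<Longrightarrow> norm (f :: Hinf) \<le> K"
  unfolding norm_Hinf_def by (intro cSUP_least) auto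

lemma Hinf_norm_ge: "cmod (fun_of f z) \<le> norm (f :: Hinf)"
proof -
  have *: "cmod (fun_of f w) \<le> norm f" if "norm w < 1" for w
    unfolding norm_Hinf_def using that by (intro cSUP_upper fun_of_bdd) (auto simp: dist_norm)
  have "0 \<le> norm f"
    using order_trans[OF norm_ge_zero *[of 0]] by simp
  with * show ?thesis
    by (cases "norm z < 1") (auto simp: fun_of_outside)
qed

lemma Hinf_norm_nonneg: "0 \<le> norm (f :: Hinf)"
  by (rule order_trans[OF norm_ge_zero Hinf_norm_ge])

instance
proof
  fix f g :: Hinf and a :: real
  have zero: "norm (0 :: Hinf) = 0"
    by (simp add: norm_Hinf_def zero_Hinf.rep_eq)
  show "norm f = 0 \<longleftrightarrow> f = 0"
  proof
    assume "norm f = 0"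
    then have "fun_of f z = 0" for z
      using Hinf_norm_ge[of f z] by simp
    then show "f = 0"
      by transfer (simp add: fun_eq_iff)
  qed (simp add: zero)
  show "norm (f + g) \<le> norm f + norm g"
    by (rule Hinf_norm_le)
      (simp add: plus_Hinf.rep_eq norm_triangle_le add_mono Hinf_norm_ge)
  show "norm (f * g) \<le> norm f * norm g"
    by (rule Hinf_norm_le)
      (simp add: times_Hinf.rep_eq norm_mult Hinf_norm_ge Hinf_norm_nonneg mult_mono)
  show "norm (1 :: Hinf) = 1"
  proof (rule antisym)
    show "norm (1 :: Hinf) \<le> 1"
      by (rule Hinf_norm_le) (simp add: one_Hinf.rep_eq)
    show "1 \<le> norm (1 :: Hinf)"
      using Hinf_norm_ge[of 1 0] by (simp add: one_Hinf.rep_eq)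
  qed
  show "norm (a *\<^sub>R f) = \<bar>a\<bar> * norm f"
  proof -
    have *: "norm (a *\<^sub>R f) \<le> \<bar>a\<bar> * norm f" for a and f :: Hinf
      by (rule Hinf_norm_le)
        (simp add: scaleR_Hinf_def scaleC_Hinf.rep_eq norm_mult Hinf_norm_ge mult_left_mono)
    show ?thesis
    proof (cases "a = 0")
      case False
      have "norm f \<le> \<bar>inverse a\<bar> * norm (a *\<^sub>R f)"
        using *[of "inverse a" "a *\<^sub>R f"] False by simp
      then have "\<bar>a\<bar> * norm f \<le> norm (a *\<^sub>R f)"
        using False by (simp add: field_simps abs_inverse)
      with *[of a f] show ?thesis
        by simp
    qed (simp add: zero)
  qed
qed (fact dist_Hinf_def sgn_Hinf_def uniformity_Hinf_def open_Hinf_def)+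

end

section \<open>The spectrum and its Gleason parts\<close>

definition spectrum_Hinf :: "(Hinf \<Rightarrow> complex) set"
  where "spectrum_Hinf = {\<phi>.
    (\<forall>f g. \<phi> (f + g) = \<phi> f + \<phi> g) \<and>
    (\<forall>a f. \<phi> (scaleC_Hinf a f) = a * \<phi> f) \<and>
    (\<forall>f g. \<phi> (f * g) = \<phi> f * \<phi> g) \<and>
    (\<exists>f. \<phi> f \<noteq> 0)}"

text \<open>For \<open>\<phi>\<close> in the spectrum, \<open>cmod (\<phi> f) \<le> norm f\<close> (if \<open>\<phi> f = k\<close> with
  \<open>norm f < cmod k\<close>, then \<open>f - k\<close> is invertible but killed by \<open>\<phi>\<close>), so the real supremum
  below is taken over a nonempty set bounded by 1.\<close>

definition pseudohyp :: "(Hinf \<Rightarrow> complex) \<Rightarrow> (Hinf \<Rightarrow> complex) \<Rightarrow> real"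
  where "pseudohyp \<phi> \<psi> = Sup {cmod (\<phi> f) | f. norm f \<le> 1 \<and> \<psi> f = 0}"

definition gleason_rel :: "((Hinf \<Rightarrow> complex) \<times> (Hinf \<Rightarrow> complex)) set"
  where "gleason_rel =
    {(\<phi>, \<psi>). \<phi> \<in> spectrum_Hinf \<and> \<psi> \<in> spectrum_Hinf \<and> pseudohyp \<phi> \<psi> < 1}"

definition gleason_parts :: "(Hinf \<Rightarrow> complex) set set"
  where "gleason_parts = spectrum_Hinf // gleason_rel"

section \<open>The maps induced by prepending a coordinate\<close>

text \<open>Meaningful for \<open>cmod b < 1\<close> only; see \<open>fun_of_comp_cons\<close> below.\<close>

definition comp_cons :: "complex \<Rightarrow> Hinf \<Rightarrow> Hinf"
  where "comp_cons b f = Hinf (fun_of f \<circ> cons_c0 b)"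

definition R :: "complex \<Rightarrow> (Hinf \<Rightarrow> complex) \<Rightarrow> (Hinf \<Rightarrow> complex)"
  where "R b \<phi> = (\<lambda>f. \<phi> (comp_cons b f))"

lemma has_derivative_cons_c0: "(cons_c0 b has_derivative cons_c0 0) (at z)"
proof -
  have "bounded_linear (cons_c0 0)"
  proof (rule bounded_linear_intro[where K = 1])
    show "cons_c0 0 (x + y) = cons_c0 0 x + cons_c0 0 y" for x y
      by transfer (auto simp: fun_eq_iff split: nat.split)
    show "cons_c0 0 (a *\<^sub>R x) = a *\<^sub>R cons_c0 0 x" for a x
      by transfer (auto simp: fun_eq_iff split: nat.split)
    show "norm (cons_c0 0 x) \<le> norm x * 1" for x
      by (rule c0_norm_le)
        (simp add: cons_c0.rep_eq c0_norm_ge split: nat.split)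
  qed
  moreover have "cons_c0 b = (\<lambda>z. cons_c0 b 0 + cons_c0 0 z)"
    by (rule ext, transfer) (auto simp: fun_eq_iff split: nat.split)
  ultimately show ?thesis
    using has_derivative_add[OF has_derivative_const bounded_linear_imp_has_derivative,
        of "cons_c0 0" "cons_c0 b 0" "at z"] by simp
qed

lemma fun_of_comp_cons:
  assumes "cmod b < 1"
  shows "fun_of (comp_cons b f) = fun_of f \<circ> cons_c0 b"
proof -
  have "c0_holomorphic_on (fun_of f \<circ> cons_c0 b) (ball 0 1)"
    unfolding c0_holomorphic_on_def
  proof
    fix z :: c0 assume "z \<in> ball 0 1"
    then have "cons_c0 b z \<in> ball 0 1"
      using cons_c0_in_ball[OF assms] by (simp add: dist_norm)
    then obtain D where D: "(fun_of f has_derivative D) (at (cons_c0 b z))"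
      "\<forall>a h. D (scaleC_c0 a h) = a * D h"
      using fun_of[of f] unfolding c0_holomorphic_on_def by blast
    have "cons_c0 0 (scaleC_c0 a h) = scaleC_c0 a (cons_c0 0 h)" for a h
      by transfer (auto simp: fun_eq_iff split: nat.split)
    then show "\<exists>D. (fun_of f \<circ> cons_c0 b has_derivative D) (at z) \<and>
        (\<forall>a h. D (scaleC_c0 a h) = a * D h)"
      using diff_chain_at[OF has_derivative_cons_c0 D(1)] D(2) by (intro exI[of _ "D \<circ> cons_c0 0"]) simp
  qed
  moreover have "bounded ((fun_of f \<circ> cons_c0 b) ` ball 0 1)"
    using Hinf_norm_ge by (auto simp: bounded_iff intro!: exI[of _ "norm f"])
  moreover have "(fun_of f \<circ> cons_c0 b) z = 0" if "z \<notin> ball 0 1" for z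
    using that cons_c0_in_ballD by (auto intro: fun_of_outside)
  ultimately show ?thesis
    unfolding comp_cons_def by (intro Hinf_inverse) auto
qed

end

theory Submission
  imports Defs "HOL-Complex_Analysis.Complex_Analysis"
begin

text \<open>Elements of the spectrum are contractive, so \<open>\<bar>R b \<phi> f - R c \<phi> f\<bar>\<close> is at most the supremum
  over \<open>z\<close> of \<open>\<bar>f (b, z) - f (c, z)\<bar>\<close>. For fixed \<open>z\<close> the Schwarz lemma in the first coordinate bounds
  this difference by a multiple of \<open>\<bar>b - c\<bar>\<close> that depends only on \<open>b\<close>.\<close>

section \<open>Contractivity of characters\<close>

lemma c0_holomorphic_on_inverse:
  assumes "c0_holomorphic_on f U" and nz: "\<And>z. z \<in> U \<Longrightarrow> f z \<noteq> 0"
  shows "c0_holomorphic_on (\<lambda>z. inverse (f z)) U"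
  unfolding c0_holomorphic_on_def
proof
  fix z assume z: "z \<in> U"
  then obtain D where D: "(f has_derivative D) (at z)" "\<forall>a h. D (scaleC_c0 a h) = a * D h"
    using assms unfolding c0_holomorphic_on_def by meson
  show "\<exists>D. ((\<lambda>z. inverse (f z)) has_derivative D) (at z) \<and>
      (\<forall>a h. D (scaleC_c0 a h) = a * D h)"
    using D nz[OF z] by (intro exI[of _ "\<lambda>h. - (inverse (f z) * D h * inverse (f z))"] conjI
        Deriv.has_derivative_inverse) (auto simp: algebra_simps)
qed

lemma fun_of_diff: "fun_of (f - g) z = fun_of f z - fun_of g z"
  by (simp add: minus_Hinf_def uminus_Hinf_def plus_Hinf.rep_eq scaleC_Hinf.rep_eq)

text \<open>On the ball \<open>k - fun_of f z\<close> stays at distance at least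
  \<open>cmod k - norm f\<close> from 0, so its pointwise reciprocal is holomorphic and
  bounded.\<close>

lemma Hinf_inverse_exists:
  assumes "norm f < cmod k"
  shows "\<exists>g. g * (scaleC_Hinf k 1 - f) = 1"
proof -
  \<comment> \<open>The cutoff is needed because elements of \<open>Hinf\<close> vanish outside the
    ball.\<close>
  let ?g = "\<lambda>z. if z \<in> ball 0 1 then inverse (k - fun_of f z) else 0"
  have lower: "cmod k - norm f \<le> cmod (k - fun_of f z)" for z
    using Hinf_norm_ge[of f z] norm_triangle_ineq2[of k "fun_of f z"] by linarith
  then have nz: "k - fun_of f z \<noteq> 0" for z
    using assms by (metis diff_gt_0_iff_gt norm_zero not_le)
  have f: "c0_holomorphic_on (fun_of f) (ball 0 1)"
    using fun_of[of f] by simp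
  have "c0_holomorphic_on (\<lambda>z. k + (- 1) * fun_of f z) (ball 0 1)"
    by (intro c0_holomorphic_on_add c0_holomorphic_on_mult c0_holomorphic_on_const f)
  then have "c0_holomorphic_on (\<lambda>z. inverse (k - fun_of f z)) (ball 0 1)"
    by (intro c0_holomorphic_on_inverse nz) simp
  then have "c0_holomorphic_on ?g (ball 0 1)"
    by (subst c0_holomorphic_on_cong[where g = "\<lambda>z. inverse (k - fun_of f z)"]) auto
  moreover have "cmod (inverse (k - fun_of f z)) \<le> inverse (cmod k - norm f)" for z
    using lower[of z] assms by (simp add: norm_inverse le_imp_inverse_le)
  then have "bounded (?g ` ball 0 1)"
    by (auto simp: bounded_iff)
  ultimately have "fun_of (Hinf ?g) = ?g"
    by (intro Hinf_inverse) auto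
  then have "Hinf ?g * (scaleC_Hinf k 1 - f) = 1"
    using nz by (auto simp: Hinf_eq_iff times_Hinf.rep_eq fun_of_diff scaleC_Hinf.rep_eq
        one_Hinf.rep_eq)
  then show ?thesis ..
qed

lemma spectrum_one:
  assumes "\<phi> \<in> spectrum_Hinf"
  shows "\<phi> 1 = 1"
proof -
  obtain f where "\<phi> f \<noteq> 0" "\<phi> (f * 1) = \<phi> f * \<phi> 1"
    using assms unfolding spectrum_Hinf_def by blast
  then show ?thesis by simp
qed

lemma spectrum_diff:
  assumes "\<phi> \<in> spectrum_Hinf"
  shows "\<phi> (f - g) = \<phi> f - \<phi> g"
  using assms by (simp add: spectrum_Hinf_def minus_Hinf_def uminus_Hinf_def)

text \<open>Otherwise \<open>\<phi> f\<close> times the unit, minus \<open>f\<close>, would be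
  invertible and yet lie in the kernel of \<open>\<phi>\<close>, against
  \<open>\<phi> 1 = 1\<close>.\<close>

lemma spectrum_norm_le:
  assumes \<phi>: "\<phi> \<in> spectrum_Hinf"
  shows "cmod (\<phi> f) \<le> norm f"
proof (rule ccontr)
  assume "\<not> ?thesis"
  then obtain g where g: "g * (scaleC_Hinf (\<phi> f) 1 - f) = 1"
    using Hinf_inverse_exists[of f "\<phi> f"] by auto
  have "\<phi> (scaleC_Hinf (\<phi> f) 1) = \<phi> f"
    using \<phi> spectrum_one[OF \<phi>] by (simp add: spectrum_Hinf_def)
  then have "\<phi> (g * (scaleC_Hinf (\<phi> f) 1 - f)) = 0"
    using \<phi> spectrum_diff[OF \<phi>, of "scaleC_Hinf (\<phi> f) 1" f] by (simp add: spectrum_Hinf_def)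
  with g spectrum_one[OF \<phi>] show False by simp
qed

lemma R_in_spectrum:
  assumes b: "cmod b < 1" and \<phi>: "\<phi> \<in> spectrum_Hinf"
  shows "R b \<phi> \<in> spectrum_Hinf"
proof -
  note rep = Hinf_eq_iff fun_of_comp_cons[OF b]
  have "comp_cons b (f + g) = comp_cons b f + comp_cons b g" for f g
    by (simp add: rep plus_Hinf.rep_eq)
  moreover have "comp_cons b (f * g) = comp_cons b f * comp_cons b g" for f g
    by (simp add: rep times_Hinf.rep_eq)
  moreover have "comp_cons b (scaleC_Hinf a f) = scaleC_Hinf a (comp_cons b f)" for a f
    by (simp add: rep scaleC_Hinf.rep_eq)
  \<comment> \<open>The unit is the indicator of the ball, so this says that
    \<open>cons_c0 b z\<close> lies in the ball exactly when \<open>z\<close> does.\<close>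
  moreover have "comp_cons b 1 = 1"
    using cons_c0_in_ball[OF b] cons_c0_in_ballD by (auto simp: rep one_Hinf.rep_eq)
  then have "R b \<phi> 1 \<noteq> 0"
    using spectrum_one[OF \<phi>] by (simp add: R_def)
  ultimately show ?thesis
    using \<phi> unfolding spectrum_Hinf_def R_def by auto
qed

section \<open>Variation in the first coordinate\<close>

lemma has_derivative_cons_c0_fst:
  "((\<lambda>w. cons_c0 w z) has_derivative (\<lambda>w. cons_c0 w 0)) (at w)"
proof -
  have "bounded_linear (\<lambda>w. cons_c0 w 0)"
  proof (rule bounded_linear_intro[where K = 1])
    show "cons_c0 (x + y) 0 = cons_c0 x 0 + cons_c0 y 0" for x y
      by transfer (auto simp: fun_eq_iff split: nat.split)
    show "cons_c0 (a *\<^sub>R x) 0 = a *\<^sub>R cons_c0 x 0" for a x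
      by transfer (auto simp: fun_eq_iff split: nat.split)
    show "norm (cons_c0 x 0) \<le> norm x * 1" for x
      by (rule c0_norm_le) (simp add: cons_c0.rep_eq zero_c0.rep_eq split: nat.split)
  qed
  moreover have "(\<lambda>w. cons_c0 w z) = (\<lambda>w. cons_c0 0 z + cons_c0 w 0)"
    by (rule ext, transfer) (auto simp: fun_eq_iff split: nat.split)
  ultimately show ?thesis
    using has_derivative_add[OF has_derivative_const bounded_linear_imp_has_derivative,
        of "\<lambda>w. cons_c0 w 0" "cons_c0 0 z" "at w"] by simp
qed

lemma fun_of_cons_holomorphic:
  assumes "norm z < 1"
  shows "(\<lambda>w. fun_of f (cons_c0 w z)) holomorphic_on ball 0 1"
  unfolding holomorphic_on_def
proof
  fix w :: complex assume "w \<in> ball 0 1"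
  then have "cons_c0 w z \<in> ball 0 1"
    using cons_c0_in_ball[of w z] assms by simp
  then obtain D where D: "(fun_of f has_derivative D) (at (cons_c0 w z))"
    "\<And>a h. D (scaleC_c0 a h) = a * D h"
    using fun_of[of f] unfolding c0_holomorphic_on_def by blast
  \<comment> \<open>Complex homogeneity of \<open>D\<close> makes the derivative of the slice
    multiplication by the fixed number \<open>D (cons_c0 1 0)\<close>, hence a complex
    derivative.\<close>
  have "cons_c0 v 0 = scaleC_c0 v (cons_c0 1 0)" for v
    by transfer (auto simp: fun_eq_iff split: nat.split)
  then have "v * D (cons_c0 1 0) = D (cons_c0 v 0)" for v
    using D(2) by metis
  then have "((\<lambda>w. fun_of f (cons_c0 w z)) has_field_derivative D (cons_c0 1 0)) (at w)"
    by (rule has_derivative_imp_has_field_derivative[OF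
          has_derivative_compose[OF has_derivative_cons_c0_fst D(1)]])
  then show "(\<lambda>w. fun_of f (cons_c0 w z)) field_differentiable at w within ball 0 1"
    using field_differentiable_at_within field_differentiable_def by blast
qed

text \<open>The constant 3 rather than the optimal 2 makes the bound on the rescaled function strict,
  as \<open>Schwarz_Lemma\<close> requires.\<close>

lemma bounded_holomorphic_diff_le:
  assumes holo: "g holomorphic_on ball b s" and "s > 0"
    and bound: "\<And>w. w \<in> ball b s \<Longrightarrow> cmod (g w) \<le> 1"
    and c: "c \<in> ball b s"
  shows "cmod (g c - g b) \<le> 3 * cmod (c - b) / s"
proof -
  \<comment> \<open>Recentring at \<open>b\<close> and rescaling the radius to 1 yields a self-map
    of the unit disc fixing 0; the point \<open>c\<close> corresponds to
    \<open>(c - b) / of_real s\<close>.\<close>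
  let ?h = "\<lambda>w. (g (b + of_real s * w) - g b) / 3"
  have scale: "b + of_real s * w \<in> ball b s" if "cmod w < 1" for w
    using that \<open>s > 0\<close> by (simp add: dist_norm norm_mult)
  have "(g \<circ> (\<lambda>w. b + of_real s * w)) holomorphic_on ball 0 1"
    by (rule holomorphic_on_compose_gen[OF _ holo]) (auto intro!: holomorphic_intros scale)
  then have "?h holomorphic_on ball 0 1"
    by (auto intro!: holomorphic_intros simp: o_def)
  moreover have "cmod (?h w) < 1" if "cmod w < 1" for w
  proof -
    have "cmod (g (b + of_real s * w) - g b) \<le> 1 + 1"
      using bound[OF scale[OF that]] bound[of b] \<open>s > 0\<close> by (intro norm_triangle_le_diff) auto
    then show ?thesis by (simp add: norm_divide)
  qed
  moreover have "cmod ((c - b) / of_real s) < 1"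
    using c \<open>s > 0\<close> by (simp add: norm_divide dist_norm norm_minus_commute)
  ultimately have "cmod (?h ((c - b) / of_real s)) \<le> cmod ((c - b) / of_real s)"
    by (intro Schwarz_Lemma(1)) auto
  then show ?thesis
    using \<open>s > 0\<close> by (simp add: norm_divide field_simps)
qed

text \<open>The disc of radius \<open>1 - cmod b\<close> about \<open>b\<close> lies in the unit
  disc, so the Schwarz estimate applies to every slice in the first coordinate, with a bound uniform
  in \<open>z\<close>.\<close>

lemma norm_comp_cons_diff_le:
  assumes b: "cmod b < 1" and c: "cmod (c - b) < 1 - cmod b" and f: "norm f \<le> 1"
  shows "norm (comp_cons c f - comp_cons b f) \<le> 3 * cmod (c - b) / (1 - cmod b)"
proof (rule Hinf_norm_le)
  fix z :: c0 assume z: "norm z < 1"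
  have sub: "ball b (1 - cmod b) \<subseteq> ball 0 1"
  proof
    fix w assume "w \<in> ball b (1 - cmod b)"
    then show "w \<in> ball 0 1"
      using norm_triangle_sub[of w b] by (simp add: dist_norm norm_minus_commute)
  qed
  have c1: "cmod c < 1"
    using c norm_triangle_sub[of c b] by linarith
  have "cmod (fun_of f (cons_c0 c z) - fun_of f (cons_c0 b z)) \<le> 3 * cmod (c - b) / (1 - cmod b)"
    using b c order_trans[OF Hinf_norm_ge f]
    by (intro bounded_holomorphic_diff_le
        holomorphic_on_subset[OF fun_of_cons_holomorphic[OF z] sub])
      (auto simp: dist_norm norm_minus_commute)
  then show "cmod (fun_of (comp_cons c f - comp_cons b f) z) \<le> 3 * cmod (c - b) / (1 - cmod b)"
    using b c1 by (simp add: fun_of_diff fun_of_comp_cons)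
qed

lemma pseudohyp_R_le:
  assumes b: "cmod b < 1" and c: "cmod (c - b) < 1 - cmod b" and \<phi>: "\<phi> \<in> spectrum_Hinf"
  shows "pseudohyp (R b \<phi>) (R c \<phi>) \<le> 3 * cmod (c - b) / (1 - cmod b)"
  unfolding pseudohyp_def
proof (rule cSup_least)
  \<comment> \<open>The zero function shows that the supremum is over a nonempty set, as
    \<open>cSup_least\<close> requires.\<close>
  have "cmod c < 1"
    using c norm_triangle_sub[of c b] by linarith
  then have "R c \<phi> 0 = 0"
    using spectrum_diff[OF R_in_spectrum[OF _ \<phi>], of c 0 0] by simp
  then show "{cmod (R b \<phi> f) |f. norm f \<le> 1 \<and> R c \<phi> f = 0} \<noteq> {}"
    by (auto intro!: exI[of _ 0])
next
  fix x assume "x \<in> {cmod (R b \<phi> f) |f. norm f \<le> 1 \<and> R c \<phi> f = 0}"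
  then obtain f where f: "x = cmod (R b \<phi> f)" "norm f \<le> 1" "R c \<phi> f = 0"
    by blast
  \<comment> \<open>Since \<open>R c \<phi> f = 0\<close>, the value \<open>R b \<phi> f\<close> is,
    up to sign, \<open>\<phi>\<close> of the difference.\<close>
  then have "x = cmod (\<phi> (comp_cons c f - comp_cons b f))"
    by (simp add: R_def spectrum_diff[OF \<phi>])
  also have "\<dots> \<le> 3 * cmod (c - b) / (1 - cmod b)"
    using spectrum_norm_le[OF \<phi>] norm_comp_cons_diff_le[OF b c f(2)] by (rule order_trans)
  finally show "x \<le> 3 * cmod (c - b) / (1 - cmod b)" .
qed

theorem proposition3p3:
  fixes b :: complex
  assumes "b \<in> ball 0 1"
  shows "\<exists>r>0. \<forall>c\<in>ball 0 1. cmod (c - b) < r \<longrightarrow>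
    (\<forall>\<phi>\<in>spectrum_Hinf. \<exists>P\<in>gleason_parts. R b \<phi> \<in> P \<and> R c \<phi> \<in> P)"
proof (intro exI[of _ "(1 - cmod b) / 3"] conjI ballI impI)
  have b: "cmod b < 1"
    using assms by simp
  then show "(1 - cmod b) / 3 > 0"
    by simp
  fix c \<phi> assume "c \<in> ball 0 1" and r: "cmod (c - b) < (1 - cmod b) / 3"
    and \<phi>: "\<phi> \<in> spectrum_Hinf"
  then have spec: "R b \<phi> \<in> spectrum_Hinf" "R c \<phi> \<in> spectrum_Hinf"
    using b R_in_spectrum by auto
  \<comment> \<open>Stated for a general \<open>x\<close> in order to serve for both
    \<open>b\<close> and \<open>c\<close>.\<close>
  have related: "(R b \<phi>, R x \<phi>) \<in> gleason_rel"
    if "cmod (x - b) < (1 - cmod b) / 3" and "R x \<phi> \<in> spectrum_Hinf" for x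
  proof -
    \<comment> \<open>This dictates the radius \<open>(1 - cmod b) / 3\<close>.\<close>
    have "3 * cmod (x - b) / (1 - cmod b) < 1"
      using that(1) b by (simp add: field_simps)
    moreover have "cmod (x - b) < 1 - cmod b"
      using that(1) b by simp
    ultimately have "pseudohyp (R b \<phi>) (R x \<phi>) < 1"
      using pseudohyp_R_le[OF b _ \<phi>] by (meson le_less_trans)
    with spec that(2) show ?thesis
      by (simp add: gleason_rel_def)
  qed
  \<comment> \<open>The part is the class of \<open>R b \<phi>\<close>: the case
    \<open>x = b\<close> of \<open>related\<close> puts \<open>R b \<phi>\<close> into it, the case
    \<open>x = c\<close> puts \<open>R c \<phi>\<close> there.\<close>
  show "\<exists>P\<in>gleason_parts. R b \<phi> \<in> P \<and> R c \<phi> \<in> P"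
    using related[OF _ spec(1)] related[OF r spec(2)] spec(1) b
    by (intro bexI[of _ "gleason_rel `` {R b \<phi>}"]) (auto simp: gleason_parts_def quotientI)
qed

end
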